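(* Let $m\ge 1$ and $n\ge 0$ be integers and let $\alpha\ge 1$ be real. Let $z_{m,n,1}>\dots>z_{m,n,m}$ be the negative zeros and $x_{m,n,1}<\dots<x_{m,n,n}$ the positive zeros of the exceptional Laguerre polynomial of the first kind $L_{m,m+n}^{I,(\alpha)}$. Let $S(x)=L_m^{(\alpha-1)}(-x)$, let $\hat w(x)=\dfrac{|x|^{\alpha+1}e^{-x}}{S(x)^2}$, and $$T_{\hat w}(u_1,\dots,u_{m+n})=\prod_{i=1}^{m+n}\hat w(u_i)\prod_{1\le i<j\le m+n}(u_i-u_j)^2 .$$ Then the logarithmic energy function $\log T_{\hat w}(u_1,\dots,u_{m+n})$ has a saddle point at $$Z_{m,n}=(z_{m,n,1},\dots,z_{m,n,m},x_{m,n,1},\dots,x_{m,n,n}).$$ More precisely, all first partial derivatives of $\log T_{\hat w}$ vanish at $Z_{m,n}$, and $\dfrac{\partial^2\log T_{\hat w}}{\partial u_i^2}(Z_{m,n})$ is positive if $u_i$ is one of the first $m$ variables ($1\le i\le m$), and negative if $u_i$ is one of the last $n$ variables ($m+1\le i\le m+n$).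
   Context: $L_k^{(a)}$ denotes the classical Laguerre polynomial of degree $k$ with parameter $a$ (leading coefficient $(-1)^k/k!$), satisfying $xy''+(a+1-x)y'+ky=0$. Exceptional Laguerre polynomials of the first kind of codimension $m\ge1$: for $\alpha>0$ and $n\ge 0$, with $S(x)=L_m^{(\alpha-1)}(-x)$, $L_{m,m+n}^{I,(\alpha)}$ is the polynomial of degree $m+n$ with leading coefficient $\frac{(-1)^n}{m!\,n!}$ which satisfies $$y''(x)+\left(\frac{\alpha+1-x}{x}-\frac{2S'(x)}{S(x)}\right)y'(x)+\left(\frac{m+n}{x}-\frac{\alpha}{x}\frac{2S'(x)}{S(x)}\right)y(x)=0$$ (away from $0$ and the zeros of $S$); these conditions determine it uniquely. The family $\{L_{m,m+n}^{I,(\alpha)}\}_{n\ge 0}$ is orthogonal on $(0,\infty)$ with respect to $x^{\alpha}e^{-x}/S(x)^2$. It is known that for $\alpha>0$ the polynomial $L_{m,m+n}^{I,(\alpha)}$ has exactly $m$ simple zeros in $(-\infty,0)$ (exceptional zeros) and exactly $n$ simple zeros in $(0,\infty)$ (regular zeros).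
   Formalization: The saddle point claim (critical point, neither local maximum nor local minimum) is stated only for n ≥ 1, because for n = 0 the point is a strict local minimum (e.g. m = 1: second derivative 2 − 1/(α+1) > 0); the "More precisely" part is stated for all n ≥ 0. *)

theory Defs
  imports Complex_Main "HOL-Computational_Algebra.Polynomial"
begin

definition laguerre :: "nat \<Rightarrow> real \<Rightarrow> real poly" where
  "laguerre k a = (\<Sum>i\<le>k. monom ((-1) ^ i * ((real k + a) gchoose (k - i)) / fact i) i)"

lemma coeff_laguerre:
  "coeff (laguerre k a) i =
     (if i \<le> k then (-1) ^ i * ((real k + a) gchoose (k - i)) / fact i else 0)"
  by (simp add: laguerre_def coeff_sum sum.delta coeff_monom)

lemma coeff_laguerre_top: "coeff (laguerre k a) k = (-1) ^ k / fact k"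
  by (simp add: coeff_laguerre)

lemma degree_laguerre: "degree (laguerre k a) = k"
proof (rule antisym)
  show "degree (laguerre k a) \<le> k"
    by (rule degree_le) (simp add: coeff_laguerre)
  show "k \<le> degree (laguerre k a)"
    by (rule le_degree) (simp add: coeff_laguerre_top)
qed

lemma laguerre_ode:
  "[:0, 1:] * pderiv (pderiv (laguerre k a)) + [:a + 1, -1:] * pderiv (laguerre k a)
     + smult (real k) (laguerre k a) = 0"
proof (rule poly_eqI)
  fix j
  let ?c = "coeff (laguerre k a)"
  have rec: "real (Suc j) * (real j + 1 + a) * ?c (Suc j) + (real k - real j) * ?c j = 0"
  proof (cases "j < k")
    case True
    define K where "K = k - Suc j"
    have K: "k - j = Suc K" "real K = real k - real j - 1"
      using True by (auto simp: K_def)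
    let ?A = "real k + a"
    have "(?A - real K) * (?A gchoose K) = real (Suc K) * (?A gchoose Suc K)"
      using gbinomial_mult_1[of ?A K] by (simp add: algebra_simps)
    hence *: "(real j + 1 + a) * (?A gchoose K) = (real k - real j) * (?A gchoose Suc K)"
      by (simp add: K(2) algebra_simps)
    have "real (Suc j) * (real j + 1 + a) * ?c (Suc j) =
            - ((-1) ^ j / fact j) * ((real j + 1 + a) * (?A gchoose K))"
      using True by (simp add: coeff_laguerre K_def[symmetric] field_simps del: of_nat_Suc)
    also have "\<dots> = - ((real k - real j) * ?c j)"
      unfolding * using True by (simp add: coeff_laguerre K)
    finally show ?thesis by simp
  next
    case False
    thus ?thesis by (cases "j = k") (auto simp: coeff_laguerre)
  qed
  show "coeff ([:0, 1:] * pderiv (pderiv (laguerre k a)) + [:a + 1, -1:] * pderiv (laguerre k a)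
     + smult (real k) (laguerre k a)) j = coeff 0 j"
    using rec by (cases j) (simp_all add: coeff_pderiv algebra_simps)
qed

definition laguerre_neg :: "nat \<Rightarrow> real \<Rightarrow> real poly" where
  "laguerre_neg m \<alpha> = laguerre m (\<alpha> - 1) \<circ>\<^sub>p [:0, -1:]"

lemma poly_laguerre_neg: "poly (laguerre_neg m \<alpha>) x = poly (laguerre m (\<alpha> - 1)) (- x)"
  by (simp add: laguerre_neg_def poly_pcompose)

definition is_exceptional_laguerre :: "nat \<Rightarrow> nat \<Rightarrow> real \<Rightarrow> real poly \<Rightarrow> bool" where
  "is_exceptional_laguerre m n \<alpha> P \<longleftrightarrow>
     degree P = m + n \<and>
     lead_coeff P = (-1) ^ n / (fact m * fact n) \<and>
     (let S = laguerre_neg m \<alpha> in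
       \<forall>x. x \<noteq> 0 \<longrightarrow> poly S x \<noteq> 0 \<longrightarrow>
         poly (pderiv (pderiv P)) x
         + ((\<alpha> + 1 - x) / x - 2 * poly (pderiv S) x / poly S x) * poly (pderiv P) x
         + (real (m + n) / x - \<alpha> / x * (2 * poly (pderiv S) x / poly S x)) * poly P x = 0)"

text \<open>The description is proper: see \<open>exceptional_laguerre_ex1\<close> below.\<close>

definition exceptional_laguerre :: "nat \<Rightarrow> nat \<Rightarrow> real \<Rightarrow> real poly" where
  "exceptional_laguerre m n \<alpha> = (THE P. is_exceptional_laguerre m n \<alpha> P)"

lemma degree_laguerre_neg: "degree (laguerre_neg m \<alpha>) = m"
  by (simp add: laguerre_neg_def degree_pcompose degree_laguerre)

lemma coeff_laguerre_neg_top: "coeff (laguerre_neg m \<alpha>) m = 1 / fact m"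
proof -
  have "lead_coeff (laguerre_neg m \<alpha>) = lead_coeff (laguerre m (\<alpha> - 1)) * (-1) ^ m"
    unfolding laguerre_neg_def by (subst lead_coeff_comp) (auto simp: degree_laguerre)
  thus ?thesis by (simp add: degree_laguerre_neg degree_laguerre coeff_laguerre_top flip: power_mult_distrib)
qed

lemma laguerre_neg_ode:
  "[:0, 1:] * pderiv (pderiv (laguerre_neg m \<alpha>)) + [:\<alpha>, 1:] * pderiv (laguerre_neg m \<alpha>)
     = smult (real m) (laguerre_neg m \<alpha>)"
proof (subst poly_eq_poly_eq_iff[symmetric], rule ext)
  fix x :: real
  let ?L = "laguerre m (\<alpha> - 1)"
  have "poly ([:0, 1:] * pderiv (pderiv ?L) + [:\<alpha> - 1 + 1, -1:] * pderiv ?L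
     + smult (real m) ?L) (- x) = 0"
    by (subst laguerre_ode) simp
  thus "poly ([:0, 1:] * pderiv (pderiv (laguerre_neg m \<alpha>)) + [:\<alpha>, 1:] * pderiv (laguerre_neg m \<alpha>)) x
     = poly (smult (real m) (laguerre_neg m \<alpha>)) x"
    by (simp add: laguerre_neg_def pderiv_pcompose pderiv_mult pderiv_pCons pderiv_minus poly_pcompose algebra_simps)
qed

lemma is_exceptional_laguerre_iff:
  "is_exceptional_laguerre m n \<alpha> P \<longleftrightarrow>
     degree P = m + n \<and> coeff P (m + n) = (-1) ^ n / (fact m * fact n) \<and>
     (let S = laguerre_neg m \<alpha> in
       [:0, 1:] * S * pderiv (pderiv P) + ([:\<alpha> + 1, -1:] * S - [:0, 2:] * pderiv S) * pderiv P
       + (smult (real (m + n)) S - smult (2 * \<alpha>) (pderiv S)) * P = 0)"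
proof -
  define S where "S = laguerre_neg m \<alpha>"
  define D where "D = [:0, 1:] * S * pderiv (pderiv P)
    + ([:\<alpha> + 1, -1:] * S - [:0, 2:] * pderiv S) * pderiv P
    + (smult (real (m + n)) S - smult (2 * \<alpha>) (pderiv S)) * P"
  let ?E = "\<lambda>x. poly (pderiv (pderiv P)) x
         + ((\<alpha> + 1 - x) / x - 2 * poly (pderiv S) x / poly S x) * poly (pderiv P) x
         + (real (m + n) / x - \<alpha> / x * (2 * poly (pderiv S) x / poly S x)) * poly P x"
  have "S \<noteq> 0"
    using coeff_laguerre_neg_top[of m \<alpha>] by (auto simp: S_def)
  have E: "poly D x = x * poly S x * ?E x" if "x \<noteq> 0" "poly S x \<noteq> 0" for x
    using that by (simp add: D_def field_simps)
  have "(\<forall>x. x \<noteq> 0 \<longrightarrow> poly S x \<noteq> 0 \<longrightarrow> ?E x = 0) \<longleftrightarrow> D = 0"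
  proof
    assume D: "D = 0"
    show "\<forall>x. x \<noteq> 0 \<longrightarrow> poly S x \<noteq> 0 \<longrightarrow> ?E x = 0"
    proof (intro allI impI)
      fix x :: real assume x: "x \<noteq> 0" "poly S x \<noteq> 0"
      have "x * poly S x * ?E x = 0" using E[OF x] D by simp
      thus "?E x = 0" using x by (simp only: mult_eq_0_iff simp_thms)
    qed
  next
    assume *: "\<forall>x. x \<noteq> 0 \<longrightarrow> poly S x \<noteq> 0 \<longrightarrow> ?E x = 0"
    show "D = 0"
    proof (rule ccontr)
      assume "D \<noteq> 0"
      hence "[:0, 1:] * S * D \<noteq> 0" using \<open>S \<noteq> 0\<close> by simp
      moreover have "poly ([:0, 1:] * S * D) x = 0" for x
      proof (cases "x \<noteq> 0 \<and> poly S x \<noteq> 0")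
        case True
        hence "poly D x = 0" using E[of x] * by (simp only: mult_zero_right simp_thms)
        thus ?thesis by simp
      qed auto
      ultimately show False
        using poly_all_0_iff_0 by blast
    qed
  qed
  thus ?thesis
    unfolding is_exceptional_laguerre_def Let_def S_def[symmetric] D_def[symmetric]
    by (auto simp del: pderiv_0)
qed

lemma is_exceptional_laguerre_explicit:
  assumes "Q = (S + pderiv S) * y - S * pderiv y"
    and "S = laguerre_neg m \<alpha>" and "y = laguerre n (\<alpha> - 1)"
  shows "is_exceptional_laguerre m n \<alpha> Q"
proof -
  let ?S1 = "pderiv S" and ?y1 = "pderiv y"
  let ?S2 = "pderiv ?S1" and ?y2 = "pderiv ?y1"
  have S: "[:0, 1:] * ?S2 + [:\<alpha>, 1:] * ?S1 = smult (real m) S"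
    using laguerre_neg_ode[of m \<alpha>] assms by simp
  have y: "[:0, 1:] * ?y2 + [:\<alpha>, -1:] * ?y1 + smult (real n) y = 0"
    using laguerre_ode[of n "\<alpha> - 1"] assms by simp
  have dS: "degree S = m" "coeff S m = 1 / fact m"
    using assms degree_laguerre_neg coeff_laguerre_neg_top by auto
  have dy: "degree y = n" "coeff y n = (-1) ^ n / fact n"
    using assms degree_laguerre coeff_laguerre_top by auto
  have lower1: "coeff (?S1 * y) (m + n) = 0"
  proof (cases "m = 0")
    case True
    with dS have "?S1 = 0" by (simp add: pderiv_eq_0_iff)
    thus ?thesis by simp
  next
    case False
    thus ?thesis
      by (intro coeff_eq_0 le_less_trans[OF degree_mult_le]) (simp add: degree_pderiv dS dy)
  qed
  have lower2: "coeff (S * ?y1) (m + n) = 0"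
  proof (cases "n = 0")
    case True
    with dy have "?y1 = 0" by (simp add: pderiv_eq_0_iff)
    thus ?thesis by simp
  next
    case False
    thus ?thesis
      by (intro coeff_eq_0 le_less_trans[OF degree_mult_le]) (simp add: degree_pderiv dS dy)
  qed
  have top: "coeff Q (m + n) = (-1) ^ n / (fact m * fact n)"
    using coeff_mult_degree_sum[of S y] lower1 lower2
    by (simp add: assms(1) dS dy distrib_right)
  have "degree Q \<le> m + n"
    unfolding assms(1)
    by (intro degree_diff_le degree_mult_le[THEN order_trans] add_mono degree_add_le)
      (auto simp: degree_pderiv dS dy)
  moreover have "m + n \<le> degree Q"
    by (rule le_degree) (simp add: top)
  ultimately have deg: "degree Q = m + n" by simp
  have "[:0, 1:] * S * pderiv (pderiv Q) + ([:\<alpha> + 1, -1:] * S - [:0, 2:] * pderiv S) * pderiv Q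
       + (smult (real (m + n)) S - smult (2 * \<alpha>) (pderiv S)) * Q = 0" (is "?D = 0")
  proof -
    have "poly ?D x = 0" for x
    proof -
      have S': "pderiv ([:0, 1:] * ?S2 + [:\<alpha>, 1:] * ?S1) = pderiv (smult (real m) S)"
        by (simp only: S)
      have y': "pderiv ([:0, 1:] * ?y2 + [:\<alpha>, -1:] * ?y1 + smult (real n) y) = pderiv 0"
        by (simp only: y)
      define s0 s1 s2 s3 where s: "s0 = poly S x" "s1 = poly ?S1 x" "s2 = poly ?S2 x"
        "s3 = poly (pderiv ?S2) x"
      define y0 y1 y2 y3 where y_defs: "y0 = poly y x" "y1 = poly ?y1 x" "y2 = poly ?y2 x"
        "y3 = poly (pderiv ?y2) x"
      have 1: "x * s2 + (\<alpha> + x) * s1 = m * s0"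
        using arg_cong[OF S, of "\<lambda>p. poly p x"] by (simp add: s algebra_simps)
      have 2: "x * s3 + s2 + (\<alpha> + x) * s2 + s1 = m * s1"
        using arg_cong[OF S', of "\<lambda>p. poly p x"]
        by (simp add: s pderiv_mult pderiv_pCons pderiv_add pderiv_diff pderiv_smult algebra_simps)
      have 3: "x * y2 + (\<alpha> - x) * y1 + n * y0 = 0"
        using arg_cong[OF y, of "\<lambda>p. poly p x"] by (simp add: y_defs algebra_simps)
      have 4: "x * y3 + y2 + (\<alpha> - x) * y2 - y1 + n * y1 = 0"
        using arg_cong[OF y', of "\<lambda>p. poly p x"]
        by (simp add: y_defs pderiv_mult pderiv_pCons pderiv_add pderiv_diff pderiv_smult algebra_simps)
      have Q0: "poly Q x = (s0 + s1) * y0 - s0 * y1"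
        by (simp add: assms(1) s y_defs)
      have Q1: "poly (pderiv Q) x = (s1 + s2) * y0 + s0 * y1 - s0 * y2"
        by (simp add: assms(1) s y_defs pderiv_mult pderiv_add pderiv_diff algebra_simps)
      have Q2: "poly (pderiv (pderiv Q)) x =
          (s2 + s3) * y0 + (s1 + s2) * y1 + s1 * y1 + s0 * y2 - s1 * y2 - s0 * y3"
        by (simp add: assms(1) s y_defs pderiv_mult pderiv_add pderiv_diff algebra_simps)
      have "poly ?D x = x * s0 * poly (pderiv (pderiv Q)) x
          + ((\<alpha> + 1 - x) * s0 - 2 * x * s1) * poly (pderiv Q) x
          + ((real m + real n) * s0 - 2 * \<alpha> * s1) * poly Q x"
        by (simp add: s algebra_simps)
      also have "\<dots> = 0"
        unfolding Q0 Q1 Q2 using 1 2 3 4 by algebra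
      finally show ?thesis .
    qed
    thus ?thesis using poly_all_0_iff_0 by blast
  qed
  thus ?thesis
    using deg top assms by (simp add: is_exceptional_laguerre_iff Let_def)
qed

lemma is_exceptional_laguerre_unique:
  assumes "is_exceptional_laguerre m n \<alpha> P" "is_exceptional_laguerre m n \<alpha> Q"
  shows "P = Q"
proof (rule ccontr)
  assume "P \<noteq> Q"
  define S where "S = laguerre_neg m \<alpha>"
  define R where "R = P - Q"
  define k where "k = degree R"
  have "R \<noteq> 0" using \<open>P \<noteq> Q\<close> by (simp add: R_def)
  have P: "degree P = m + n" "coeff P (m + n) = (-1) ^ n / (fact m * fact n)"
    and Q: "degree Q = m + n" "coeff Q (m + n) = (-1) ^ n / (fact m * fact n)"
    using assms by (auto simp: is_exceptional_laguerre_iff)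
  have "k \<le> m + n" unfolding k_def R_def by (intro degree_diff_le) (auto simp: P Q)
  moreover have "k \<noteq> m + n"
    using \<open>R \<noteq> 0\<close> P Q leading_coeff_0_iff[of R] by (auto simp: k_def R_def)
  ultimately have k: "k < m + n" by simp
  have dS: "degree S = m" "coeff S m \<noteq> 0"
    using degree_laguerre_neg coeff_laguerre_neg_top by (auto simp: S_def)
  have lin: "a * pderiv (pderiv R) + b * pderiv R + c * R = 0"
    if "a * pderiv (pderiv P) + b * pderiv P + c * P = 0"
      "a * pderiv (pderiv Q) + b * pderiv Q + c * Q = 0" for a b c
  proof -
    have "a * pderiv (pderiv R) + b * pderiv R + c * R =
        (a * pderiv (pderiv P) + b * pderiv P + c * P)
        - (a * pderiv (pderiv Q) + b * pderiv Q + c * Q)"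
      by (simp add: R_def pderiv_diff algebra_simps)
    thus ?thesis using that by simp
  qed
  have D: "[:0, 1:] * S * pderiv (pderiv R) + ([:\<alpha> + 1, -1:] * S - [:0, 2:] * pderiv S) * pderiv R
       + (smult (real (m + n)) S - smult (2 * \<alpha>) (pderiv S)) * R = 0"
    by (rule lin)
      (use assms in \<open>simp_all only: is_exceptional_laguerre_iff Let_def S_def[symmetric]\<close>)
  define A where
    "A = [:0, 1:] * pderiv (pderiv R) + [:\<alpha> + 1, -1:] * pderiv R + smult (real (m + n)) R"
  define B where "B = [:0, 2:] * pderiv R + smult (2 * \<alpha>) R"
  have "S * A = pderiv S * B"
    using D by (simp add: A_def B_def algebra_simps)
  have coeff_A: "coeff A i = real (Suc i) * (real i + 1 + \<alpha>) * coeff R (Suc i)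
      + (real (m + n) - real i) * coeff R i" for i
    by (cases i) (simp_all add: A_def coeff_pderiv algebra_simps)
  have above: "coeff R i = 0" if "i > k" for i
    using that by (simp add: k_def coeff_eq_0)
  have A_k: "coeff A k \<noteq> 0"
    using k \<open>R \<noteq> 0\<close> by (simp add: coeff_A above) (simp add: k_def)
  have "degree A \<le> k"
    by (rule degree_le) (simp add: coeff_A above)
  hence dA: "degree A = k" using le_degree[OF A_k] by simp
  have dB: "degree B \<le> k"
  proof (rule degree_le, intro allI impI)
    fix i assume "k < i"
    thus "coeff B i = 0"
      by (cases i) (simp_all add: B_def coeff_pderiv above)
  qed
  have "coeff (S * A) (m + k) \<noteq> 0"
    using coeff_mult_degree_sum[of S A] dS A_k by (simp add: dA)
  moreover have "coeff (pderiv S * B) (m + k) = 0"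
  proof (cases "m = 0")
    case True
    with dS have "pderiv S = 0" by (simp add: pderiv_eq_0_iff)
    thus ?thesis by simp
  next
    case False
    thus ?thesis using dB
      by (intro coeff_eq_0 le_less_trans[OF degree_mult_le]) (simp add: degree_pderiv dS)
  qed
  ultimately show False using \<open>S * A = pderiv S * B\<close> by simp
qed

lemma exceptional_laguerre_ex1: "\<exists>!P. is_exceptional_laguerre m n \<alpha> P"
  using is_exceptional_laguerre_explicit is_exceptional_laguerre_unique by blast

lemma is_exceptional_laguerre_exceptional_laguerre:
  "is_exceptional_laguerre m n \<alpha> (exceptional_laguerre m n \<alpha>)"
  unfolding exceptional_laguerre_def by (rule theI'[OF exceptional_laguerre_ex1])

text \<open>
  A point of \<open>\<real>\<^sup>N\<close> is represented by a function on \<open>nat\<close>, of which only the values on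
  \<open>{1..N}\<close> matter.
\<close>

definition energy_weight :: "nat \<Rightarrow> real \<Rightarrow> real \<Rightarrow> real" where
  "energy_weight m \<alpha> x = \<bar>x\<bar> powr (\<alpha> + 1) * exp (- x) / (poly (laguerre_neg m \<alpha>) x)\<^sup>2"

definition energy :: "(real \<Rightarrow> real) \<Rightarrow> nat \<Rightarrow> (nat \<Rightarrow> real) \<Rightarrow> real" where
  "energy w N u = (\<Prod>i=1..N. w (u i)) * (\<Prod>i=1..N. \<Prod>j\<in>{i<..N}. (u i - u j)\<^sup>2)"

definition has_partial :: "((nat \<Rightarrow> real) \<Rightarrow> real) \<Rightarrow> nat \<Rightarrow> (nat \<Rightarrow> real) \<Rightarrow> real \<Rightarrow> bool" where
  "has_partial f i u d \<longleftrightarrow> ((\<lambda>t. f (u(i := t))) has_real_derivative d) (at (u i))"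

text \<open>
  The partial derivative must exist along the whole line near \<open>u\<close>; \<open>g\<close> is its restriction to
  that line.
\<close>

definition has_second_partial :: "((nat \<Rightarrow> real) \<Rightarrow> real) \<Rightarrow> nat \<Rightarrow> (nat \<Rightarrow> real) \<Rightarrow> real \<Rightarrow> bool" where
  "has_second_partial f i u d \<longleftrightarrow>
     (\<exists>g. (\<forall>\<^sub>F t in nhds (u i). has_partial f i (u(i := t)) (g t)) \<and>
          (g has_real_derivative d) (at (u i)))"

text \<open>A critical point that is neither a local maximum nor a local minimum.\<close>

definition saddle_point :: "nat \<Rightarrow> ((nat \<Rightarrow> real) \<Rightarrow> real) \<Rightarrow> (nat \<Rightarrow> real) \<Rightarrow> bool" where
  "saddle_point N f u \<longleftrightarrow>
     (\<forall>i\<in>{1..N}. has_partial f i u 0) \<and>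
     (\<forall>e>0. \<exists>v. (\<forall>i\<in>{1..N}. \<bar>v i - u i\<bar> < e) \<and> f v > f u) \<and>
     (\<forall>e>0. \<exists>v. (\<forall>i\<in>{1..N}. \<bar>v i - u i\<bar> < e) \<and> f v < f u)"

end

theory Submission
  imports Defs
begin

text \<open>
  Write \<open>y = L_n^(\<alpha>-1)\<close> and \<open>P = (S + S')y - Sy'\<close> for the exceptional polynomial. Up to a constant,
  \<open>P\<close> is the product of the \<open>t - Z_i\<close>; with \<open>P = c (t - Z_k) Q\<close>, the \<open>k\<close>-th partial derivative of
  the logarithmic energy is \<open>(\<alpha>+1)/t - 1 - 2S'/S + 2Q'/Q\<close>, which vanishes at \<open>Z_k\<close> by the
  differential equation of \<open>P\<close>.

  At a negative zero \<open>a\<close>, differentiating that equation once more expresses the second derivative as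
  a quadratic in \<open>s = aS'(a)/S(a)\<close>. As \<open>P(a) = 0\<close> means \<open>1 + S'/S = y'/y \<le> 0\<close>, we have
  \<open>s \<ge> -a\<close>, and then every term of the quadratic is nonnegative.

  At a positive zero \<open>a\<close>, the identity \<open>tP' + \<alpha>P = (m+n+\<alpha>) S y\<close> shows that \<open>S\<close> changes sign between
  consecutive negative zeros of \<open>P\<close>, and between the largest one and \<open>0\<close>. Hence the zeros of \<open>S\<close>
  satisfy \<open>\<zeta>_1 < 0\<close> and \<open>\<zeta>_(j+1) < z_j\<close>, so the sum of the \<open>(a - \<zeta>_j)^(-2)\<close> is less than \<open>a^(-2)\<close>
  plus the sum of the \<open>(a - z_j)^(-2)\<close>, and the second derivative is below \<open>(1 - \<alpha>)/a^2 \<le> 0\<close>.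
\<close>

section \<open>Laguerre polynomials and the exceptional polynomial\<close>

text \<open>The binomial coefficient is a product of factors \<open>real k + a - j\<close> with
  \<open>j < k - i\<close>, each at least \<open>i + 1 + a > 0\<close>, divided by a
  factorial.\<close>

lemma coeff_laguerre_alternating:
  assumes "a > -1"
  shows "(-1) ^ i * coeff (laguerre k a) i \<ge> 0"
proof (cases "i \<le> k")
  case True
  have "(real k + a) gchoose (k - i) \<ge> 0"
    unfolding gbinomial_prod_rev using assms True
    by (intro divide_nonneg_nonneg prod_nonneg) auto
  thus ?thesis using True by (simp add: coeff_laguerre flip: power_add mult.assoc)
qed (simp add: coeff_laguerre)

text \<open>The i-th term is \<open>(-1) ^ i * coeff p i\<close> times \<open>(- x) ^ i\<close>, so
  no term is negative and the constant one is a lower bound for the sum.\<close>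

lemma poly_ge_coeff_0_if_coeffs_alternating:
  fixes p :: "real poly"
  assumes "\<And>i. (-1) ^ i * coeff p i \<ge> 0" "x \<le> 0"
  shows "poly p x \<ge> coeff p 0"
proof -
  have eq: "coeff p i * x ^ i = ((-1) ^ i * coeff p i) * (- x) ^ i" for i
    by (simp add: power_minus[of x])
  have nn: "coeff p i * x ^ i \<ge> 0" for i
    unfolding eq by (rule mult_nonneg_nonneg[OF assms(1)]) (use assms(2) in simp)
  have "coeff p 0 * x ^ 0 \<le> (\<Sum>i\<le>degree p. coeff p i * x ^ i)"
    by (rule member_le_sum) (use nn in auto)
  thus ?thesis by (simp add: poly_altdef)
qed

text \<open>The constant coefficient is strictly positive. With \<open>a = \<alpha> - 1\<close> this
  makes \<open>y\<close> positive on the closed negative half-line and gives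
  \<open>S(0) > 0\<close>.\<close>

lemma laguerre_pos:
  assumes "a > -1" "x \<le> 0"
  shows "poly (laguerre k a) x > 0"
proof -
  have "(real k + a) gchoose k > 0"
    unfolding gbinomial_prod_rev using assms
    by (intro divide_pos_pos prod_pos) auto
  hence "coeff (laguerre k a) 0 > 0" by (simp add: coeff_laguerre)
  also have "\<dots> \<le> poly (laguerre k a) x"
    by (intro poly_ge_coeff_0_if_coeffs_alternating coeff_laguerre_alternating assms)
  finally show ?thesis .
qed

text \<open>Differentiation shifts the index by one, so it is the negated derivative whose
  coefficients alternate, starting with a nonnegative one.\<close>

lemma pderiv_laguerre_nonpos:
  assumes "a > -1" "x \<le> 0"
  shows "poly (pderiv (laguerre k a)) x \<le> 0"
proof -
  have alt: "(-1) ^ i * coeff (- pderiv (laguerre k a)) i \<ge> 0" for i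
    using coeff_laguerre_alternating[OF assms(1), of "Suc i" k]
    by (simp add: coeff_pderiv mult.left_commute mult_nonneg_nonneg zero_le_mult_iff mult_le_0_iff)
  from poly_ge_coeff_0_if_coeffs_alternating[OF alt assms(2)] alt[of 0]
  show ?thesis by simp
qed

lemma exceptional_laguerre_eq:
  "exceptional_laguerre m n \<alpha> =
     (laguerre_neg m \<alpha> + pderiv (laguerre_neg m \<alpha>)) * laguerre n (\<alpha> - 1)
       - laguerre_neg m \<alpha> * pderiv (laguerre n (\<alpha> - 1))"
  by (rule is_exceptional_laguerre_unique[OF is_exceptional_laguerre_exceptional_laguerre
        is_exceptional_laguerre_explicit[OF refl refl refl]])

lemma poly_laguerre_ode:
  "x * poly (pderiv (pderiv (laguerre k a))) x + (a + 1 - x) * poly (pderiv (laguerre k a)) x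
     + real k * poly (laguerre k a) x = 0"
  using arg_cong[OF laguerre_ode[of k a], of "\<lambda>p. poly p x"] by (simp add: algebra_simps)

lemma poly_laguerre_neg_ode:
  "x * poly (pderiv (pderiv (laguerre_neg m \<alpha>))) x + (\<alpha> + x) * poly (pderiv (laguerre_neg m \<alpha>)) x
     = real m * poly (laguerre_neg m \<alpha>) x"
  using arg_cong[OF laguerre_neg_ode[of m \<alpha>], of "\<lambda>p. poly p x"] by (simp add: algebra_simps)

text \<open>The equations of \<open>S\<close> and \<open>y\<close> eliminate both second derivatives
  from \<open>x P'(x)\<close>. At a zero of \<open>P\<close> the identity ties \<open>P'\<close> to
  \<open>S y\<close>, which transfers simplicity and signs from \<open>P'\<close> to
  \<open>S\<close>.\<close>

lemma exceptional_laguerre_first_order: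
  "x * poly (pderiv (exceptional_laguerre m n \<alpha>)) x + \<alpha> * poly (exceptional_laguerre m n \<alpha>) x
     = (real m + real n + \<alpha>) * poly (laguerre_neg m \<alpha>) x * poly (laguerre n (\<alpha> - 1)) x"
  using poly_laguerre_ode[of x n "\<alpha> - 1"] poly_laguerre_neg_ode[of x m \<alpha>]
  by (simp add: exceptional_laguerre_eq pderiv_mult pderiv_add pderiv_diff) algebra

lemma exceptional_laguerre_ode:
  fixes m n :: nat and \<alpha> :: real
  defines "S \<equiv> laguerre_neg m \<alpha>" and "P \<equiv> exceptional_laguerre m n \<alpha>"
  shows "[:0, 1:] * S * pderiv (pderiv P) + ([:\<alpha> + 1, -1:] * S - [:0, 2:] * pderiv S) * pderiv P
       + (smult (real (m + n)) S - smult (2 * \<alpha>) (pderiv S)) * P = 0"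
  using is_exceptional_laguerre_exceptional_laguerre[of m n \<alpha>]
  by (simp only: is_exceptional_laguerre_iff Let_def S_def P_def)

text \<open>Both sides have the same degree and leading coefficient and agree at as many distinct
  points as the degree.\<close>

lemma poly_eq_prod_roots:
  fixes p :: "'a :: field poly"
  assumes "finite A" "inj_on a A" "card A = degree p" "\<And>i. i \<in> A \<Longrightarrow> poly p (a i) = 0"
  shows "p = smult (lead_coeff p) (\<Prod>i\<in>A. [:- a i, 1:])"
proof (cases "p = 0")
  case False
  have deg: "degree (\<Prod>i\<in>A. [:- a i, 1:]) = card A"
    by (subst degree_prod_eq_sum_degree) auto
  show ?thesis
  proof (rule poly_eqI_degree_lead_coeff[where n = "degree p" and A = "a ` A"])
    show "degree p \<le> degree p" ..
    show "coeff p (degree p) = coeff (smult (lead_coeff p) (\<Prod>i\<in>A. [:- a i, 1:])) (degree p)"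
      using lead_coeff_prod[of "\<lambda>i. [:- a i, 1:]" A] by (simp add: deg assms(3))
  qed (use assms False in \<open>auto simp: card_image deg poly_prod prod_zero_iff\<close>)
qed simp

text \<open>The left side is the derivative of \<open>q'/q\<close>, and \<open>q'/q\<close> is the
  sum of the \<open>1 / (x - a i)\<close>. The induction splits off one linear factor.\<close>

lemma prod_linear_second_log_deriv:
  fixes a :: "'b \<Rightarrow> 'a :: field_char_0"
  assumes "finite A" "\<And>i. i \<in> A \<Longrightarrow> a i \<noteq> x"
  defines "q \<equiv> (\<Prod>i\<in>A. [:- a i, 1:])"
  shows "(poly (pderiv (pderiv q)) x * poly q x - (poly (pderiv q) x)\<^sup>2) / (poly q x)\<^sup>2
           = - (\<Sum>i\<in>A. 1 / (x - a i)\<^sup>2)"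
  using assms(1,2) unfolding q_def
proof (induction A)
  case (insert b A)
  define r where "r = (\<Prod>i\<in>A. [:- a i, 1:])"
  have r: "poly r x \<noteq> 0" "x - a b \<noteq> 0"
    using insert.prems insert.hyps by (auto simp: r_def poly_prod prod_zero_iff)
  have "(\<Prod>i\<in>insert b A. [:- a i, 1:]) = [:- a b, 1:] * r"
    using insert.hyps by (simp add: r_def)
  moreover have "(poly (pderiv (pderiv ([:- a b, 1:] * r))) x * poly ([:- a b, 1:] * r) x
      - (poly (pderiv ([:- a b, 1:] * r)) x)\<^sup>2) = 
      (x - a b)\<^sup>2 * (poly (pderiv (pderiv r)) x * poly r x - (poly (pderiv r) x)\<^sup>2) - (poly r x)\<^sup>2"
    by (simp add: pderiv_mult pderiv_pCons pderiv_add pderiv_diff pderiv_smult pderiv_minus) algebra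
  moreover have "poly ([:- a b, 1:] * r) x = (x - a b) * poly r x"
    by (simp add: algebra_simps)
  moreover have "(poly (pderiv (pderiv r)) x * poly r x - (poly (pderiv r) x)\<^sup>2) / (poly r x)\<^sup>2
           = - (\<Sum>i\<in>A. 1 / (x - a i)\<^sup>2)"
    using insert unfolding r_def by simp
  hence "((x - a b)\<^sup>2 * (poly (pderiv (pderiv r)) x * poly r x - (poly (pderiv r) x)\<^sup>2)
      - (poly r x)\<^sup>2) / ((x - a b) * poly r x)\<^sup>2 = - (1 / (x - a b)\<^sup>2 + (\<Sum>i\<in>A. 1 / (x - a i)\<^sup>2))"
    using r by (simp add: diff_divide_distrib power_mult_distrib)
  ultimately show ?case
    using insert.hyps by (simp only: sum.insert simp_thms)
qed simp

section \<open>Partial derivatives of the energy\<close>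

text \<open>All factors that do not involve the \<open>k\<close>-th coordinate are collected in
  \<open>C\<close>, which is positive because the other coordinates are distinct and have positive
  weight.\<close>

lemma energy_fun_upd:
  assumes "k \<in> {1..N}"
    and "\<And>i. i \<in> {1..N} - {k} \<Longrightarrow> w (u i) > 0" and "inj_on u ({1..N} - {k})"
  shows "\<exists>C>0. \<forall>t. energy w N (u(k := t)) = C * w t * (\<Prod>i\<in>{1..N} - {k}. t - u i)\<^sup>2"
proof -
  let ?A = "{1..N} - {k}"
  define C where "C = (\<Prod>i\<in>?A. w (u i)) * (\<Prod>i\<in>?A. \<Prod>j\<in>{i<..N} - {k}. (u i - u j)\<^sup>2)"
  have "C > 0"
    unfolding C_def
  proof (intro mult_pos_pos prod_pos assms(2))
    fix i j assume ij: "i \<in> ?A" "j \<in> {i<..N} - {k}"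
    hence "j \<in> ?A" "i \<noteq> j" by auto
    with ij(1) have "u i \<noteq> u j" using inj_onD[OF assms(3), of i j] by blast
    thus "(u i - u j)\<^sup>2 > 0" by simp
  qed
  moreover have "energy w N (u(k := t)) = C * w t * (\<Prod>i\<in>?A. t - u i)\<^sup>2" for t
  proof -
    let ?v = "u(k := t)"
    have w: "(\<Prod>i=1..N. w (?v i)) = w t * (\<Prod>i\<in>?A. w (u i))"
      using assms(1) by (simp add: prod.remove[of _ k])
    \<comment> \<open>The pair of \<open>i\<close> and \<open>k\<close> occurs in the row of the
      smaller index: here if \<open>i < k\<close>, otherwise in the row of \<open>k\<close>, which
      is split off separately.\<close>
    have inner: "(\<Prod>j\<in>{i<..N}. (?v i - ?v j)\<^sup>2) =
        (if i < k then (t - u i)\<^sup>2 else 1) * (\<Prod>j\<in>{i<..N} - {k}. (u i - u j)\<^sup>2)" if "i \<in> ?A" for i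
    proof (cases "i < k")
      case True
      thus ?thesis using assms(1) that
        by (simp add: prod.remove[of "{i<..N}" k] power2_commute[of "u i" t])
    qed (use that in \<open>auto intro!: prod.cong\<close>)
    have "(\<Prod>i=1..N. \<Prod>j\<in>{i<..N}. (?v i - ?v j)\<^sup>2) =
        (\<Prod>j\<in>{k<..N}. (?v k - ?v j)\<^sup>2) * (\<Prod>i\<in>?A. \<Prod>j\<in>{i<..N}. (?v i - ?v j)\<^sup>2)"
      by (rule prod.remove) (use assms(1) in auto)
    also have "(\<Prod>i\<in>?A. \<Prod>j\<in>{i<..N}. (?v i - ?v j)\<^sup>2) =
        (\<Prod>i\<in>?A. if i < k then (t - u i)\<^sup>2 else 1) *
        (\<Prod>i\<in>?A. \<Prod>j\<in>{i<..N} - {k}. (u i - u j)\<^sup>2)"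
      unfolding prod.distrib[symmetric] by (rule prod.cong[OF refl inner])
    also have "(\<Prod>j\<in>{k<..N}. (?v k - ?v j)\<^sup>2) = (\<Prod>j\<in>{k<..N}. (t - u j)\<^sup>2)"
      by (rule prod.cong) auto
    also have "(\<Prod>i\<in>?A. if i < k then (t - u i)\<^sup>2 else 1) = (\<Prod>i\<in>{1..<k}. (t - u i)\<^sup>2)"
      using assms(1) by (intro prod.mono_neutral_cong_right) auto
    also have "(\<Prod>j\<in>{k<..N}. (t - u j)\<^sup>2) * ((\<Prod>i\<in>{1..<k}. (t - u i)\<^sup>2) *
        (\<Prod>i\<in>?A. \<Prod>j\<in>{i<..N} - {k}. (u i - u j)\<^sup>2)) =
        (\<Prod>i\<in>{1..<k} \<union> {k<..N}. (t - u i)\<^sup>2) * (\<Prod>i\<in>?A. \<Prod>j\<in>{i<..N} - {k}. (u i - u j)\<^sup>2)"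
      by (subst prod.union_disjoint) auto
    also have "{1..<k} \<union> {k<..N} = ?A"
      using assms(1) by auto
    finally show ?thesis
      unfolding energy_def w C_def by (simp add: prod_power_distrib)
  qed
  ultimately show ?thesis by blast
qed

text \<open>Taking the logarithm of a square lets one rule cover functions of either sign.\<close>

lemma DERIV_ln_square:
  fixes f :: "real \<Rightarrow> real"
  assumes "(f has_real_derivative f') (at x)" "f x \<noteq> 0"
  shows "((\<lambda>x. ln ((f x)\<^sup>2)) has_real_derivative 2 * f' / f x) (at x)"
proof -
  have "f x * f x > 0"
    using assms(2) by (simp flip: power2_eq_square)
  thus ?thesis
    using assms by (auto intro!: derivative_eq_intros simp: power2_eq_square)
qed

lemma energy_weight_pos: "x \<noteq> 0 \<Longrightarrow> poly (laguerre_neg m \<alpha>) x \<noteq> 0 \<Longrightarrow> energy_weight m \<alpha> x > 0"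
  by (simp add: energy_weight_def)

lemma eventually_poly_nonzero:
  fixes p :: "real poly"
  assumes "poly p x \<noteq> 0"
  shows "\<forall>\<^sub>F t in nhds x. poly p t \<noteq> 0"
  using assms
  by (auto simp: eventually_nhds intro!: exI[of _ "{t. poly p t \<noteq> 0}"] open_Collect_neq continuous_intros)

lemma ln_energy_has_partial:
  fixes m N k :: nat and \<alpha> t :: real and u :: "nat \<Rightarrow> real"
  defines "S \<equiv> laguerre_neg m \<alpha>" and "Q \<equiv> \<Prod>i\<in>{1..N} - {k}. [:- u i, 1:]"
  assumes k: "k \<in> {1..N}" and inj: "inj_on u ({1..N} - {k})"
    and u: "\<And>i. i \<in> {1..N} - {k} \<Longrightarrow> u i \<noteq> 0" "\<And>i. i \<in> {1..N} - {k} \<Longrightarrow> poly S (u i) \<noteq> 0"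
    and t: "t \<noteq> 0" "poly S t \<noteq> 0" "poly Q t \<noteq> 0"
  shows "has_partial (\<lambda>u. ln (energy (energy_weight m \<alpha>) N u)) k (u(k := t))
    ((\<alpha> + 1) / t - 1 - 2 * poly (pderiv S) t / poly S t + 2 * poly (pderiv Q) t / poly Q t)"
proof -
  obtain C where C: "C > 0" "\<And>t. energy (energy_weight m \<alpha>) N (u(k := t)) =
      C * energy_weight m \<alpha> t * (\<Prod>i\<in>{1..N} - {k}. t - u i)\<^sup>2"
    using energy_fun_upd[OF k, of "energy_weight m \<alpha>" u] u inj energy_weight_pos
    unfolding S_def by blast
  have Q: "(\<Prod>i\<in>{1..N} - {k}. s - u i) = poly Q s" for s
    by (simp add: Q_def poly_prod)
  \<comment> \<open>The logarithm of \<open>\<bar>s\<bar>\<close> is written as half of that of its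
    square, so that every logarithm is one of a square. The single condition says that
    \<open>s\<close>, \<open>S(s)\<close> and \<open>Q(s)\<close> are all nonzero.\<close>
  have ln_eq: "ln (energy (energy_weight m \<alpha>) N (u(k := s))) =
      ln C + (\<alpha> + 1) / 2 * ln (s\<^sup>2) - s - ln ((poly S s)\<^sup>2) + ln ((poly Q s)\<^sup>2)"
    if "poly ([:0, 1:] * S * Q) s \<noteq> 0" for s
  proof -
    have s: "s \<noteq> 0" "poly S s \<noteq> 0" "poly Q s \<noteq> 0" using that by auto
    have "ln (s\<^sup>2) = 2 * ln \<bar>s\<bar>"
      using s ln_realpow[of "\<bar>s\<bar>" 2] by simp
    thus ?thesis
      using s C(1) unfolding C(2) Q energy_weight_def S_def[symmetric]
      by (simp add: ln_mult ln_div ln_powr)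
  qed
  \<comment> \<open>Nonvanishing of the product is an open condition, so the formula holds in a
    neighbourhood of \<open>t\<close>, which is enough for the derivative.\<close>
  have ev: "\<forall>\<^sub>F s in nhds t. ln (energy (energy_weight m \<alpha>) N (u(k := s))) =
      ln C + (\<alpha> + 1) / 2 * ln (s\<^sup>2) - s - ln ((poly S s)\<^sup>2) + ln ((poly Q s)\<^sup>2)"
    using eventually_poly_nonzero[of "[:0, 1:] * S * Q" t] t ln_eq
    by (auto elim!: eventually_mono)
  have "((\<lambda>s. ln C + (\<alpha> + 1) / 2 * ln (s\<^sup>2) - s - ln ((poly S s)\<^sup>2) + ln ((poly Q s)\<^sup>2))
      has_real_derivative (0 + (\<alpha> + 1) / 2 * (2 * 1 / t) - 1 - 2 * poly (pderiv S) t / poly S t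
        + 2 * poly (pderiv Q) t / poly Q t)) (at t)"
    by (intro DERIV_add DERIV_diff DERIV_cmult DERIV_const DERIV_ln_square DERIV_ident poly_DERIV t)
  moreover have "0 + (\<alpha> + 1) / 2 * (2 * 1 / t) = (\<alpha> + 1) / t"
    using t by (simp add: field_simps)
  ultimately have "((\<lambda>s. ln (energy (energy_weight m \<alpha>) N (u(k := s)))) has_real_derivative
     ((\<alpha> + 1) / t - 1 - 2 * poly (pderiv S) t / poly S t + 2 * poly (pderiv Q) t / poly Q t)) (at t)"
    by (subst DERIV_cong_ev[OF refl ev refl]) (simp only:)
  thus ?thesis by (simp add: has_partial_def)
qed

lemma DERIV_poly_log_deriv:
  fixes p :: "real poly"
  assumes "poly p x \<noteq> 0"
  shows "((\<lambda>t. 2 * poly (pderiv p) t / poly p t) has_real_derivative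
    2 * ((poly (pderiv (pderiv p)) x * poly p x - (poly (pderiv p) x)\<^sup>2) / (poly p x)\<^sup>2)) (at x)"
  using assms by (auto intro!: derivative_eq_intros simp: power2_eq_square algebra_simps)

text \<open>As \<open>g\<close> vanishes at \<open>u i\<close> with positive derivative, it is
  positive just to the right, so \<open>f\<close> strictly increases along that coordinate
  line.\<close>

lemma second_partial_increase:
  assumes "\<forall>\<^sub>F t in nhds (u i). has_partial f i (u(i := t)) (g t)"
    and "(g has_real_derivative d) (at (u i))" "d > 0" "g (u i) = 0" "e > 0"
  shows "\<exists>v. (\<forall>j. \<bar>v j - u j\<bar> < e) \<and> f v > f u"
proof -
  obtain r where r: "r > 0" "\<And>t. dist t (u i) < r \<Longrightarrow> has_partial f i (u(i := t)) (g t)"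
    using assms(1) by (auto simp: eventually_nhds_metric)
  obtain q where q: "q > 0" "\<And>h. 0 < h \<Longrightarrow> h < q \<Longrightarrow> g (u i) < g (u i + h)"
    using DERIV_pos_inc_right[OF assms(2,3)] by blast
  \<comment> \<open>Halving keeps \<open>h\<close> strictly below all three bounds: closeness to
    \<open>u\<close>, existence of the partial derivative, positivity of \<open>g\<close>.\<close>
  define h where "h = min e (min r q) / 2"
  have h: "0 < h" "h < e" "h < r" "h < q"
    using r(1) q(1) assms(5) by (auto simp: h_def min_def)
  let ?F = "\<lambda>t. f (u(i := t))"
  have D: "(?F has_real_derivative g t) (at t)" if "u i \<le> t" "t \<le> u i + h" for t
    using r(2)[of t] that h by (simp add: has_partial_def dist_real_def)
  have "?F (u i) < ?F (u i + h)"
  proof (rule DERIV_pos_imp_increasing_open[where f = ?F])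
    show "\<exists>y. (?F has_real_derivative y) (at t) \<and> y > 0" if "u i < t" "t < u i + h" for t
      using D[of t] q(2)[of "t - u i"] that h assms(4) by auto
    show "continuous_on {u i..u i + h} ?F"
      using D by (auto intro!: DERIV_isCont continuous_at_imp_continuous_on)
  qed (use h in auto)
  thus ?thesis using h by (intro exI[of _ "u(i := u i + h)"]) auto
qed

lemma second_partial_decrease:
  assumes "\<forall>\<^sub>F t in nhds (u i). has_partial f i (u(i := t)) (g t)"
    and "(g has_real_derivative d) (at (u i))" "d < 0" "g (u i) = 0" "e > 0"
  shows "\<exists>v. (\<forall>j. \<bar>v j - u j\<bar> < e) \<and> f v < f u"
proof -
  have "\<exists>v. (\<forall>j. \<bar>v j - u j\<bar> < e) \<and> - f v > - f u"
  proof (rule second_partial_increase)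
    show "\<forall>\<^sub>F t in nhds (u i). has_partial (\<lambda>v. - f v) i (u(i := t)) (- g t)"
      using assms(1) by (rule eventually_mono) (auto simp: has_partial_def intro!: DERIV_minus)
    show "((\<lambda>t. - g t) has_real_derivative - d) (at (u i))"
      using assms(2) by (rule DERIV_minus)
  qed (use assms in auto)
  thus ?thesis by simp
qed

section \<open>Interlacing of the exceptional zeros with the zeros of \<open>S\<close>\<close>

lemma poly_same_sign:
  fixes p :: "real poly"
  assumes "u < v" "\<And>t. u \<le> t \<Longrightarrow> t \<le> v \<Longrightarrow> poly p t \<noteq> 0"
  shows "poly p u * poly p v > 0"
proof (rule ccontr)
  assume "\<not> ?thesis"
  moreover have "poly p u \<noteq> 0" "poly p v \<noteq> 0" using assms by auto
  ultimately have "poly p u * poly p v < 0" by (simp add: not_less less_le)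
  from poly_IVT[OF assms(1) this] assms(2) show False by (meson less_imp_le)
qed

text \<open>Dividing out the root leaves a factor \<open>r\<close> with \<open>r(u) = p'(u)\<close>,
  without zeros on the closed interval, and with the sign of \<open>p\<close> at
  \<open>v\<close>.\<close>

lemma pderiv_sign_at_last_root:
  fixes p :: "real poly"
  assumes "u < v" "poly p u = 0" "poly (pderiv p) u \<noteq> 0"
    and "\<And>t. u < t \<Longrightarrow> t \<le> v \<Longrightarrow> poly p t \<noteq> 0"
  shows "poly (pderiv p) u * poly p v > 0"
proof -
  obtain r where p: "p = [:- u, 1:] * r"
    using assms(2) by (auto simp: poly_eq_0_iff_dvd dvd_def)
  have d: "poly (pderiv p) u = poly r u"
    by (simp add: p pderiv_mult pderiv_pCons pderiv_add pderiv_diff pderiv_smult pderiv_minus)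
  have "poly r u * poly r v > 0"
  proof (rule poly_same_sign[OF assms(1)])
    fix t assume t: "u \<le> t" "t \<le> v"
    show "poly r t \<noteq> 0"
    proof (cases "t = u")
      case False
      thus ?thesis using assms(4)[of t] t by (auto simp: p)
    qed (use d assms(3) in auto)
  qed
  moreover have "poly p v = (v - u) * poly r v"
    by (simp add: p algebra_simps)
  ultimately show ?thesis using assms(1)
    by (simp add: d mult.left_commute[of _ "v - u"])
qed

text \<open>Dividing out the root \<open>v\<close> leaves \<open>r\<close> with
  \<open>p'(v) = r(v)\<close> and \<open>p'(u) = (u - v) r'(u)\<close>. The preceding lemma applies
  to \<open>r\<close>, and \<open>u - v\<close> reverses the sign.\<close>

lemma pderiv_sign_at_consecutive_roots:
  fixes p :: "real poly"
  assumes "u < v" "poly p u = 0" "poly p v = 0" "poly (pderiv p) u \<noteq> 0" "poly (pderiv p) v \<noteq> 0"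
    and "\<And>t. u < t \<Longrightarrow> t < v \<Longrightarrow> poly p t \<noteq> 0"
  shows "poly (pderiv p) u * poly (pderiv p) v < 0"
proof -
  obtain r where p: "p = [:- v, 1:] * r"
    using assms(3) by (auto simp: poly_eq_0_iff_dvd dvd_def)
  have d: "poly (pderiv p) t = poly r t + (t - v) * poly (pderiv r) t" for t
    by (simp add: p pderiv_mult pderiv_pCons pderiv_add pderiv_diff pderiv_smult pderiv_minus algebra_simps)
  have ru: "poly r u = 0" using assms(1,2) by (simp add: p)
  have dr: "poly (pderiv p) u = (u - v) * poly (pderiv r) u" "poly (pderiv p) v = poly r v"
    using d[of u] d[of v] ru by auto
  have "poly (pderiv r) u * poly r v > 0"
  proof (rule pderiv_sign_at_last_root[OF assms(1) ru])
    fix t assume t: "u < t" "t \<le> v"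
    show "poly r t \<noteq> 0"
    proof (cases "t = v")
      case False
      thus ?thesis using assms(6)[of t] t by (auto simp: p)
    qed (use dr assms(5) in auto)
  qed (use dr assms(4) in auto)
  moreover have "poly (pderiv p) u * poly (pderiv p) v = (u - v) * (poly (pderiv r) u * poly r v)"
    by (simp add: dr)
  ultimately show ?thesis using assms(1) by (simp add: mult_neg_pos)
qed

text \<open>At a zero of \<open>P\<close> the first-order identity gives \<open>S(t)\<close> the
  sign of \<open>t P'(t)\<close>, since \<open>y\<close> is positive for \<open>t \<le> 0\<close>.
  The sign changes of \<open>P'\<close> at consecutive zeros thus become sign changes of
  \<open>S\<close>.\<close>

lemma laguerre_neg_roots_interlace:
  fixes m n :: nat and \<alpha> :: real and z :: "nat \<Rightarrow> real"
  defines "S \<equiv> laguerre_neg m \<alpha>" and "P \<equiv> exceptional_laguerre m n \<alpha>"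
  assumes \<alpha>: "\<alpha> > 0"
    and z: "strict_antimono_on {1..m} z" "z ` {1..m} = {t. t < 0 \<and> poly P t = 0}"
    and simple: "\<And>i. i \<in> {1..m} \<Longrightarrow> poly (pderiv P) (z i) \<noteq> 0"
  obtains \<zeta> where "\<And>i. i \<in> {1..m} \<Longrightarrow> poly S (\<zeta> i) = 0"
    and "\<And>i. i \<in> {1..m} \<Longrightarrow> z i < \<zeta> i"
    and "\<And>i. i \<in> {1..m} \<Longrightarrow> \<zeta> i < (if i = 1 then 0 else z (i - 1))"
proof -
  \<comment> \<open>The zeros are numbered from right to left, so the right neighbour of
    \<open>z i\<close> is \<open>z (i - 1)\<close>, with \<open>0\<close> in its place for
    \<open>i = 1\<close>.\<close>
  let ?b = "\<lambda>i. if i = 1 then 0 else z (i - 1)"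
  let ?y = "poly (laguerre n (\<alpha> - 1))" and ?K = "real m + real n + \<alpha>"
  have y: "?K * ?y t > 0" if "t \<le> 0" for t
    using laguerre_pos[of "\<alpha> - 1" t n] \<alpha> that by simp
  have first: "t * poly (pderiv P) t + \<alpha> * poly P t = (?K * ?y t) * poly S t" for t
    using exceptional_laguerre_first_order[of t m n \<alpha>] by (simp add: S_def P_def mult_ac)
  have zD: "z i < 0" "poly P (z i) = 0" if "i \<in> {1..m}" for i
    using z(2) that by blast+
  have anti: "z j < z i" if "i \<in> {1..m}" "j \<in> {1..m}" "i < j" for i j
    using z(1) that by (auto simp: monotone_on_def)
  have S_z: "(?K * ?y (z i)) * poly S (z i) = z i * poly (pderiv P) (z i)" if "i \<in> {1..m}" for i
    using first[of "z i"] zD[OF that] by simp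
  have "\<exists>t>z i. t < ?b i \<and> poly S t = 0" if i: "i \<in> {1..m}" for i
  proof (rule poly_IVT)
    show less: "z i < ?b i"
      using zD[OF i] anti[of "i - 1" i] i by auto
    have b_le: "?b i \<le> 0"
    proof (cases "i = 1")
      case False
      hence "i - 1 \<in> {1..m}" using i by auto
      thus ?thesis using zD(1)[of "i - 1"] by simp
    qed simp
    have no_root: "poly P t \<noteq> 0" if t: "z i < t" "t < ?b i" for t
    proof
      assume "poly P t = 0"
      moreover have "t < 0" using t b_le by linarith
      ultimately obtain j where j: "j \<in> {1..m}" "t = z j"
        using z(2) by blast
      have "j < i" using anti[of i j] j i t(1) by (metis less_asym linorder_neqE_nat)
      moreover have "\<not> j < i - 1"
      proof
        assume "j < i - 1"
        moreover from this have "i - 1 \<in> {1..m}" "i \<noteq> 1" using i j(1) by auto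
        ultimately show False using anti[of j "i - 1"] j t(2) by simp
      qed
      ultimately have "j = i - 1" "i \<noteq> 1" using j(1) by auto
      thus False using j(2) t(2) by simp
    qed
    \<comment> \<open>The positive factors \<open>?K * ?y\<close> stay attached to \<open>S\<close>
      so that the first-order identity can be substituted; they are cancelled at the end.\<close>
    have "(?K * ?y (z i) * poly S (z i)) * (?K * ?y (?b i) * poly S (?b i)) < 0"
    proof (cases "i = 1")
      case True
      have y0: "?K * ?y 0 > 0" by (rule y) simp
      have S0: "poly S 0 > 0"
        using laguerre_pos[of "\<alpha> - 1" 0 m] \<alpha> by (simp add: S_def poly_laguerre_neg)
      \<comment> \<open>The endpoint \<open>0\<close> is not a zero of \<open>P\<close>: there the
        identity loses its derivative term and yields \<open>P(0) > 0\<close>. This forces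
        \<open>P' > 0\<close> and hence \<open>S < 0\<close> at the largest negative zero.\<close>
      have eq: "\<alpha> * poly P 0 = ?K * ?y 0 * poly S 0" using first[of 0] by simp
      have P0: "poly P 0 > 0"
      proof -
        have "\<alpha> * poly P 0 > 0" unfolding eq using y0 S0 by simp
        thus ?thesis using \<alpha> by (simp add: zero_less_mult_iff)
      qed
      have "poly (pderiv P) (z i) * poly P 0 > 0"
      proof (rule pderiv_sign_at_last_root)
        show "poly P t \<noteq> 0" if "z i < t" "t \<le> 0" for t
          using no_root[of t] that P0 True by (cases "t = 0") auto
      qed (use zD[OF i] simple[OF i] in auto)
      hence "poly (pderiv P) (z i) > 0" using P0 by (simp add: zero_less_mult_iff)
      hence "?K * ?y (z i) * poly S (z i) < 0" unfolding S_z[OF i]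
        using zD[OF i] by (simp add: mult_neg_pos)
      moreover have "?K * ?y 0 * poly S 0 > 0" using y0 S0 by simp
      ultimately show ?thesis using True by (simp add: mult_neg_pos)
    next
      case False
      hence i1: "i - 1 \<in> {1..m}" using i by auto
      have "poly (pderiv P) (z i) * poly (pderiv P) (z (i - 1)) < 0"
        by (rule pderiv_sign_at_consecutive_roots)
          (use less zD[OF i] zD[OF i1] simple[OF i] simple[OF i1] no_root False in auto)
      \<comment> \<open>Both zeros are negative, so passing from \<open>P'\<close> to
        \<open>t P'\<close> keeps the sign of the product.\<close>
      moreover have "z i * z (i - 1) > 0"
        using zD(1)[OF i] zD(1)[OF i1] by (simp add: mult_neg_neg)
      ultimately have "(z i * z (i - 1)) * (poly (pderiv P) (z i) * poly (pderiv P) (z (i - 1))) < 0"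
        by (rule mult_pos_neg[rotated])
      also have "(z i * z (i - 1)) * (poly (pderiv P) (z i) * poly (pderiv P) (z (i - 1))) =
          (?K * ?y (z i) * poly S (z i)) * (?K * ?y (?b i) * poly S (?b i))"
      proof -
        have b: "?b i = z (i - 1)" using False by simp
        show ?thesis unfolding b S_z[OF i] S_z[OF i1] by (simp only: mult_ac)
      qed
      finally show ?thesis .
    qed
    also have "(?K * ?y (z i) * poly S (z i)) * (?K * ?y (?b i) * poly S (?b i)) =
        ((?K * ?y (z i)) * (?K * ?y (?b i))) * (poly S (z i) * poly S (?b i))"
      by (simp only: mult_ac)
    finally have "((?K * ?y (z i)) * (?K * ?y (?b i))) * (poly S (z i) * poly S (?b i)) < 0" .
    moreover have "(?K * ?y (z i)) * (?K * ?y (?b i)) > 0"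
      by (intro mult_pos_pos[of "?K * _" "?K * _"] y b_le) (use zD[OF i] in simp)
    ultimately show "poly S (z i) * poly S (?b i) < 0"
      by (metis mult_less_cancel_left_pos mult_zero_right)
  qed
  hence "\<exists>\<zeta>. \<forall>i\<in>{1..m}. z i < \<zeta> i \<and> \<zeta> i < ?b i \<and> poly S (\<zeta> i) = 0"
    by (intro bchoice) blast
  thus ?thesis using that by blast
qed

text \<open>Each \<open>\<zeta> i\<close> lies farther from \<open>x\<close> than its right
  neighbour among \<open>0\<close> and the \<open>z j\<close>, so the sums compare term by
  term.\<close>

lemma sum_inverse_squares_interlace:
  fixes x :: real and z \<zeta> :: "nat \<Rightarrow> real"
  assumes "m \<ge> 1" "x > 0" "\<And>i. i \<in> {1..m} \<Longrightarrow> z i < 0"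
    and "\<And>i. i \<in> {1..m} \<Longrightarrow> \<zeta> i < (if i = 1 then 0 else z (i - 1))"
  shows "(\<Sum>i=1..m. 1 / (x - \<zeta> i)\<^sup>2) < 1 / x\<^sup>2 + (\<Sum>i=1..m. 1 / (x - z i)\<^sup>2)"
proof -
  let ?b = "\<lambda>i. if i = 1 then 0 else z (i - 1)"
  have "(\<Sum>i=1..m. 1 / (x - \<zeta> i)\<^sup>2) < (\<Sum>i=1..m. 1 / (x - ?b i)\<^sup>2)"
  proof (rule sum_strict_mono)
    fix i assume i: "i \<in> {1..m}"
    have "?b i \<le> 0"
    proof (cases "i = 1")
      case False
      hence "i - 1 \<in> {1..m}" using i by auto
      thus ?thesis using assms(3)[of "i - 1"] by simp
    qed simp
    hence "0 < x - ?b i" using assms(2) by linarith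
    moreover have "x - ?b i < x - \<zeta> i" using assms(4)[OF i] by linarith
    ultimately show "1 / (x - \<zeta> i)\<^sup>2 < 1 / (x - ?b i)\<^sup>2"
      by (intro divide_strict_left_mono power_strict_mono mult_pos_pos zero_less_power) auto
  qed (use assms(1) in auto)
  also have "(\<Sum>i=1..m. 1 / (x - ?b i)\<^sup>2) = 1 / x\<^sup>2 + (\<Sum>i=2..m. 1 / (x - z (i - 1))\<^sup>2)"
  proof -
    have "{1..m} = insert 1 {2..m}" using assms(1) by auto
    thus ?thesis by simp
  qed
  also have "(\<Sum>i=2..m. 1 / (x - z (i - 1))\<^sup>2) = (\<Sum>i=1..m - 1. 1 / (x - z i)\<^sup>2)"
    by (rule sum.reindex_bij_witness[of _ Suc "\<lambda>i. i - 1"]) auto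
  \<comment> \<open>The leftmost zero \<open>z m\<close> is no right neighbour; its term is added
    here.\<close>
  also have "\<dots> \<le> (\<Sum>i=1..m. 1 / (x - z i)\<^sup>2)"
    by (rule sum_mono2) auto
  finally show ?thesis by simp
qed

section \<open>The equations at a zero\<close>

text \<open>Up to \<open>c\<close>, the first three derivatives of \<open>P\<close> at
  \<open>a\<close> are \<open>Q(a)\<close>, \<open>2 Q'(a)\<close> and \<open>3 Q''(a)\<close>. The
  equation of \<open>P\<close> at \<open>a\<close> therefore determines \<open>Q'/Q\<close>, its
  derivative determines \<open>Q''/Q\<close>, and the equation of \<open>S\<close> determines
  \<open>S''/S\<close>; only \<open>s\<close> remains. The factor \<open>6 * a\<^sup>2\<close>
  clears the denominators \<open>2 a\<close> and \<open>3 a\<close> that arise.\<close>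

lemma exceptional_laguerre_zero_relations:
  fixes m n :: nat and \<alpha> a c :: real and Q :: "real poly"
  defines "S \<equiv> laguerre_neg m \<alpha>"
  defines "s \<equiv> a * poly (pderiv S) a / poly S a"
  assumes P: "exceptional_laguerre m n \<alpha> = smult c ([:- a, 1:] * Q)" and "c \<noteq> 0"
    and a: "a \<noteq> 0" and Sa: "poly S a \<noteq> 0" and Qa: "poly Q a \<noteq> 0"
  shows "(\<alpha> + 1) / a - 1 - 2 * poly (pderiv S) a / poly S a + 2 * poly (pderiv Q) a / poly Q a = 0"
    and "6 * a\<^sup>2 * (- (\<alpha> + 1) / a\<^sup>2
        - 2 * ((poly (pderiv (pderiv S)) a * poly S a - (poly (pderiv S) a)\<^sup>2) / (poly S a)\<^sup>2)
        + 2 * ((poly (pderiv (pderiv Q)) a * poly Q a - (poly (pderiv Q) a)\<^sup>2) / (poly Q a)\<^sup>2))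
      = \<alpha>\<^sup>2 - 1 - (8 * real m + 4 * real n + 2 * \<alpha> + 2) * a + a\<^sup>2 + 8 * s * (s + a) + (8 * \<alpha> - 4) * s"
proof -
  let ?P = "[:- a, 1:] * Q"
  define D where "D = [:0, 1:] * S * pderiv (pderiv ?P)
    + ([:\<alpha> + 1, -1:] * S - [:0, 2:] * pderiv S) * pderiv ?P
    + (smult (real (m + n)) S - smult (2 * \<alpha>) (pderiv S)) * ?P"
  have "smult c D = 0"
    using exceptional_laguerre_ode[of m \<alpha> n]
    by (simp only: P S_def[symmetric] D_def pderiv_smult smult_add_right mult_smult_right)
  hence D: "D = 0" using \<open>c \<noteq> 0\<close> by simp
  define s0 s1 s2 where s_defs: "s0 = poly S a" "s1 = poly (pderiv S) a"
    "s2 = poly (pderiv (pderiv S)) a"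
  define q0 q1 q2 where q_defs: "q0 = poly Q a" "q1 = poly (pderiv Q) a"
    "q2 = poly (pderiv (pderiv Q)) a"
  note d = pderiv_mult pderiv_pCons pderiv_add pderiv_diff pderiv_smult pderiv_minus
  have 1: "2 * a * s0 * q1 + ((\<alpha> + 1 - a) * s0 - 2 * a * s1) * q0 = 0"
    using arg_cong[OF D, of "\<lambda>p. poly p a"]
    by (simp add: D_def d s_defs q_defs algebra_simps)
  have 2: "2 * (s0 + a * s1) * q1 + 3 * a * s0 * q2
      + (- s0 + (\<alpha> + 1 - a) * s1 - 2 * s1 - 2 * a * s2) * q0
      + 2 * ((\<alpha> + 1 - a) * s0 - 2 * a * s1) * q1 + (real (m + n) * s0 - 2 * \<alpha> * s1) * q0 = 0"
    using arg_cong[OF D, of "\<lambda>p. poly (pderiv p) a"]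
    by (simp add: D_def d s_defs q_defs algebra_simps)
  have 3: "a * s2 + (\<alpha> + a) * s1 = real m * s0"
    using poly_laguerre_neg_ode[of a m \<alpha>] by (simp add: s_defs S_def)
  have nz: "s0 \<noteq> 0" "q0 \<noteq> 0" using Sa Qa by (auto simp: s_defs q_defs)
  \<comment> \<open>In these ratios the three relations become polynomial equations free of
    \<open>s0\<close> and \<open>q0\<close>, ready for algebraic elimination.\<close>
  define \<sigma> \<tau> \<rho> \<kappa> where ratio: "\<sigma> = s1 / s0" "\<tau> = s2 / s0" "\<rho> = q1 / q0" "\<kappa> = q2 / q0"
  have s: "s1 = \<sigma> * s0" "s2 = \<tau> * s0" "q1 = \<rho> * q0" "q2 = \<kappa> * q0"
    using nz by (auto simp: ratio)
  have "s0 * q0 * (2 * a * \<rho> + (\<alpha> + 1 - a) - 2 * a * \<sigma>) = 0"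
    using 1 unfolding s by (simp add: algebra_simps)
  hence 1: "2 * a * \<rho> + (\<alpha> + 1 - a) - 2 * a * \<sigma> = 0" using nz by simp
  have "s0 * q0 * (2 * (1 + a * \<sigma>) * \<rho> + 3 * a * \<kappa> + (- 1 + (\<alpha> + 1 - a) * \<sigma> - 2 * \<sigma> - 2 * a * \<tau>)
      + 2 * ((\<alpha> + 1 - a) - 2 * a * \<sigma>) * \<rho> + (real (m + n) - 2 * \<alpha> * \<sigma>)) = 0"
    using 2 unfolding s by (simp add: algebra_simps)
  hence 2: "2 * (1 + a * \<sigma>) * \<rho> + 3 * a * \<kappa> + (- 1 + (\<alpha> + 1 - a) * \<sigma> - 2 * \<sigma> - 2 * a * \<tau>)
      + 2 * ((\<alpha> + 1 - a) - 2 * a * \<sigma>) * \<rho> + (real m + real n - 2 * \<alpha> * \<sigma>) = 0"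
    using nz by simp
  have "s0 * (a * \<tau> + (\<alpha> + a) * \<sigma> - real m) = 0"
    using 3 unfolding s by (simp add: algebra_simps)
  hence 3: "a * \<tau> + (\<alpha> + a) * \<sigma> = real m" using nz by simp
  show "(\<alpha> + 1) / a - 1 - 2 * poly (pderiv S) a / poly S a + 2 * poly (pderiv Q) a / poly Q a = 0"
  proof -
    have "a * ((\<alpha> + 1) / a - 1 - 2 * \<sigma> + 2 * \<rho>) = 0"
      using 1 a by (simp add: field_simps)
    thus ?thesis using a by (simp add: ratio s_defs q_defs)
  qed
  have "(s2 * s0 - s1\<^sup>2) / s0\<^sup>2 = \<tau> - \<sigma>\<^sup>2" "(q2 * q0 - q1\<^sup>2) / q0\<^sup>2 = \<kappa> - \<rho>\<^sup>2"
    using nz by (simp_all add: ratio field_simps power2_eq_square)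
  moreover have "s = a * \<sigma>"
    by (simp add: s_def ratio s_defs)
  moreover have "6 * a\<^sup>2 * (- (\<alpha> + 1) / a\<^sup>2 - 2 * (\<tau> - \<sigma>\<^sup>2) + 2 * (\<kappa> - \<rho>\<^sup>2))
      = - 6 * (\<alpha> + 1) - 12 * a\<^sup>2 * (\<tau> - \<sigma>\<^sup>2) + 12 * a\<^sup>2 * (\<kappa> - \<rho>\<^sup>2)"
    using a by (simp add: field_simps)
  moreover have "\<dots> = \<alpha>\<^sup>2 - 1 - (8 * real m + 4 * real n + 2 * \<alpha> + 2) * a + a\<^sup>2
      + 8 * (a * \<sigma>) * (a * \<sigma> + a) + (8 * \<alpha> - 4) * (a * \<sigma>)"
    using 1 2 3 by algebra
  ultimately show "6 * a\<^sup>2 * (- (\<alpha> + 1) / a\<^sup>2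
        - 2 * ((poly (pderiv (pderiv S)) a * poly S a - (poly (pderiv S) a)\<^sup>2) / (poly S a)\<^sup>2)
        + 2 * ((poly (pderiv (pderiv Q)) a * poly Q a - (poly (pderiv Q) a)\<^sup>2) / (poly Q a)\<^sup>2))
      = \<alpha>\<^sup>2 - 1 - (8 * real m + 4 * real n + 2 * \<alpha> + 2) * a + a\<^sup>2 + 8 * s * (s + a) + (8 * \<alpha> - 4) * s"
    by (simp only: s_defs q_defs)
qed

text \<open>Dividing \<open>P(a) = 0\<close> by \<open>S(a) y(a)\<close> gives
  \<open>1 + S'/S = y'/y\<close>, where \<open>y > 0\<close> and \<open>y' \<le> 0\<close>.\<close>

lemma log_deriv_at_negative_zero:
  fixes m n :: nat and \<alpha> a :: real
  defines "S \<equiv> laguerre_neg m \<alpha>"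
  assumes "\<alpha> > 0" "a < 0" "poly (exceptional_laguerre m n \<alpha>) a = 0" "poly S a \<noteq> 0"
  shows "poly (pderiv S) a / poly S a \<le> - 1"
proof -
  define y where "y = laguerre n (\<alpha> - 1)"
  have y: "poly y a > 0" "poly (pderiv y) a \<le> 0"
    using laguerre_pos[of "\<alpha> - 1" a n] pderiv_laguerre_nonpos[of "\<alpha> - 1" a n] assms(2,3)
    by (auto simp: y_def)
  have "(poly S a + poly (pderiv S) a) * poly y a = poly S a * poly (pderiv y) a"
    using assms(4) by (simp add: exceptional_laguerre_eq S_def y_def)
  hence "poly (pderiv S) a / poly S a + 1 = poly (pderiv y) a / poly y a"
    using y assms(5) by (simp add: field_simps)
  also have "\<dots> \<le> 0" using y by (simp add: divide_nonpos_pos)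
  finally show ?thesis by simp
qed

section \<open>Critical point and second derivatives\<close>

theorem theorem1:
  fixes m n :: nat and \<alpha> :: real and z x Z :: "nat \<Rightarrow> real"
    and logT :: "(nat \<Rightarrow> real) \<Rightarrow> real"
  assumes "m \<ge> 1" and "\<alpha> \<ge> 1"
    and "strict_antimono_on {1..m} z"
    and "z ` {1..m} = {t. t < 0 \<and> poly (exceptional_laguerre m n \<alpha>) t = 0}"
    and "strict_mono_on {1..n} x"
    and "x ` {1..n} = {t. t > 0 \<and> poly (exceptional_laguerre m n \<alpha>) t = 0}"
    and "Z = (\<lambda>i. if i \<le> m then z i else x (i - m))"
    and "logT = (\<lambda>u. ln (energy (energy_weight m \<alpha>) (m + n) u))"
  shows "(n \<ge> 1 \<longrightarrow> saddle_point (m + n) logT Z) \<and>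
         (\<forall>i\<in>{1..m + n}. has_partial logT i Z 0) \<and>
         (\<forall>i\<in>{1..m}. \<exists>d>0. has_second_partial logT i Z d) \<and>
         (\<forall>i\<in>{m + 1..m + n}. \<exists>d<0. has_second_partial logT i Z d)"
proof -

  \<comment> \<open>The zeros and the factorization of \<open>P\<close>\<close>
  define S where "S = laguerre_neg m \<alpha>"
  define P where "P = exceptional_laguerre m n \<alpha>"
  define c where "c = lead_coeff P"
  define Q where "Q k = (\<Prod>i\<in>{1..m + n} - {k}. [:- Z i, 1:])" for k
  have zD: "z i < 0" "poly P (z i) = 0" if "i \<in> {1..m}" for i
    using assms(4) that unfolding P_def by blast+
  have xD: "x i > 0" "poly P (x i) = 0" if "i \<in> {1..n}" for i
    using assms(6) that unfolding P_def by blast+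
  have Z_neg: "Z i = z i" if "i \<in> {1..m}" for i
    using that by (simp add: assms(7))
  have Z_pos: "Z i = x (i - m)" "i - m \<in> {1..n}" if "i \<in> {m + 1..m + n}" for i
    using that by (auto simp: assms(7))
  have split: "i \<in> {1..m} \<or> i \<in> {m + 1..m + n}" if "i \<in> {1..m + n}" for i
    using that by auto
  have Z: "Z i \<noteq> 0" "poly P (Z i) = 0" if "i \<in> {1..m + n}" for i
    using split[OF that] zD[of i] xD[of "i - m"] Z_neg[of i] Z_pos[of i] by auto
  have inj: "inj_on Z {1..m + n}"
  proof (rule inj_onI)
    fix i j assume ij: "i \<in> {1..m + n}" "j \<in> {1..m + n}" "Z i = Z j"
    have inj_z: "inj_on z {1..m}"
      by (rule inj_onI) (metis monotone_onD[OF assms(3)] less_irrefl linorder_neqE_nat)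
    have inj_x: "inj_on x {1..n}"
      using assms(5) by (rule strict_mono_on_imp_inj_on)
    from split[OF ij(1)] split[OF ij(2)] show "i = j"
    proof (elim disjE)
      assume "i \<in> {1..m}" "j \<in> {1..m}"
      thus ?thesis using ij(3) inj_onD[OF inj_z] by (simp add: Z_neg)
    next
      assume h: "i \<in> {m + 1..m + n}" "j \<in> {m + 1..m + n}"
      hence "i - m = j - m"
        using ij(3) inj_onD[OF inj_x] Z_pos by metis
      thus ?thesis using h by auto
    next
      assume h: "i \<in> {1..m}" "j \<in> {m + 1..m + n}"
      thus ?thesis using ij(3) zD(1)[OF h(1)] xD(1)[OF Z_pos(2)[OF h(2)]] Z_neg Z_pos(1) by simp
    next
      assume h: "j \<in> {1..m}" "i \<in> {m + 1..m + n}"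
      thus ?thesis using ij(3) zD(1)[OF h(1)] xD(1)[OF Z_pos(2)[OF h(2)]] Z_neg Z_pos(1) by simp
    qed
  qed
  have P_char: "degree P = m + n" "c \<noteq> 0"
    using is_exceptional_laguerre_exceptional_laguerre[of m n \<alpha>]
    by (auto simp: is_exceptional_laguerre_def P_def c_def)
  \<comment> \<open>The distinct zeros listed by \<open>Z\<close> are as many as the degree, so
    \<open>P\<close> splits completely; simplicity of the zeros follows from this.\<close>
  have P_prod: "P = smult c (\<Prod>i\<in>{1..m + n}. [:- Z i, 1:])"
    unfolding c_def by (rule poly_eq_prod_roots) (use inj Z(2) P_char(1) in auto)
  have P_Q: "P = smult c ([:- Z k, 1:] * Q k)" if "k \<in> {1..m + n}" for k
    using P_prod that by (simp only: Q_def prod.remove[of "{1..m + n}" k] finite_atLeastAtMost)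
  have Z_neq: "Z i \<noteq> Z k" if "k \<in> {1..m + n}" "i \<in> {1..m + n} - {k}" for i k
    using inj_onD[OF inj, of i k] that by blast
  have Q_nz: "poly (Q k) (Z k) \<noteq> 0" if "k \<in> {1..m + n}" for k
  proof -
    have "\<forall>i\<in>{1..m + n} - {k}. Z k - Z i \<noteq> 0"
      using Z_neq[OF that] by (metis right_minus_eq)
    thus ?thesis by (simp add: Q_def poly_prod prod_zero_iff)
  qed
  have simple: "poly (pderiv P) (Z k) \<noteq> 0" if "k \<in> {1..m + n}" for k
    using Q_nz[OF that] P_char(2)
    by (subst P_Q[OF that]) (simp add: pderiv_smult pderiv_mult pderiv_pCons del: mult_pCons_left)
  \<comment> \<open>A common zero of \<open>P\<close> and \<open>S\<close> would make
    \<open>t P'(t)\<close> vanish there, against simplicity and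
    \<open>Z k \<noteq> 0\<close>.\<close>
  have S_nz: "poly S (Z k) \<noteq> 0" if "k \<in> {1..m + n}" for k
    using exceptional_laguerre_first_order[of "Z k" m n \<alpha>] Z[OF that] simple[OF that]
    by (auto simp: P_def S_def)

  \<comment> \<open>First and second partial derivatives at \<open>Z\<close>\<close>
  define g where "g k t = (\<alpha> + 1) / t - 1 - 2 * poly (pderiv S) t / poly S t
      + 2 * poly (pderiv (Q k)) t / poly (Q k) t" for k t
  define d where "d k = - (\<alpha> + 1) / (Z k)\<^sup>2
      - 2 * ((poly (pderiv (pderiv S)) (Z k) * poly S (Z k) - (poly (pderiv S) (Z k))\<^sup>2) / (poly S (Z k))\<^sup>2)
      + 2 * ((poly (pderiv (pderiv (Q k))) (Z k) * poly (Q k) (Z k) - (poly (pderiv (Q k)) (Z k))\<^sup>2)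
        / (poly (Q k) (Z k))\<^sup>2)" for k
  have partial: "\<forall>\<^sub>F t in nhds (Z k). has_partial logT k (Z(k := t)) (g k t)"
    if k: "k \<in> {1..m + n}" for k
  proof -
    have "poly ([:0, 1:] * S * Q k) (Z k) \<noteq> 0"
      using Z(1)[OF k] S_nz[OF k] Q_nz[OF k] by simp
    from eventually_poly_nonzero[OF this] show ?thesis
    proof (rule eventually_mono)
      fix t assume t: "poly ([:0, 1:] * S * Q k) t \<noteq> 0"
      show "has_partial logT k (Z(k := t)) (g k t)"
        unfolding assms(8) g_def S_def Q_def
        by (rule ln_energy_has_partial[OF k inj_on_subset[OF inj]])
          (use t Z(1) S_nz in \<open>auto simp: S_def Q_def\<close>)
    qed
  qed
  have critical: "g k (Z k) = 0" if k: "k \<in> {1..m + n}" for k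
    using exceptional_laguerre_zero_relations(1)[OF P_Q[OF k, unfolded P_def] P_char(2) Z(1)[OF k]]
      S_nz[OF k] Q_nz[OF k] by (simp add: g_def S_def)
  have g_deriv: "(g k has_real_derivative d k) (at (Z k))" if k: "k \<in> {1..m + n}" for k
  proof -
    have "((\<lambda>t. (\<alpha> + 1) / t - 1) has_real_derivative - (\<alpha> + 1) / (Z k)\<^sup>2) (at (Z k))"
      using Z(1)[OF k] by (auto intro!: derivative_eq_intros simp: power2_eq_square)
    from DERIV_add[OF DERIV_diff[OF this DERIV_poly_log_deriv[OF S_nz[OF k]]]
        DERIV_poly_log_deriv[OF Q_nz[OF k]]]
    show ?thesis unfolding g_def d_def .
  qed
  have first: "has_partial logT k Z 0" if k: "k \<in> {1..m + n}" for k
    using eventually_nhds_x_imp_x[OF partial[OF k]] critical[OF k] by simp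
  have second: "has_second_partial logT k Z (d k)" if k: "k \<in> {1..m + n}" for k
    unfolding has_second_partial_def using partial[OF k] g_deriv[OF k] by blast

  \<comment> \<open>Second derivatives at the negative zeros\<close>
  have d_neg_zero: "d k > 0" if k: "k \<in> {1..m}" for k
  proof -
    have k': "k \<in> {1..m + n}" using k by auto
    define a where "a = Z k"
    have a: "a < 0" using zD[OF k] Z_neg[OF k] by (simp add: a_def)
    define s where "s = a * poly (pderiv S) a / poly S a"
    have "poly (pderiv S) a / poly S a \<le> - 1"
      using log_deriv_at_negative_zero[of \<alpha> a m n] assms(2) a Z(2)[OF k'] S_nz[OF k']
      by (simp add: a_def S_def P_def)
    hence "a * (poly (pderiv S) a / poly S a) \<ge> a * (- 1)"
      using a by (intro mult_left_mono_neg) auto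
    hence s: "s \<ge> - a" by (simp add: s_def)
    \<comment> \<open>Strict positivity comes from the term linear in \<open>a < 0\<close>. The
      others are nonnegative by \<open>\<alpha> \<ge> 1\<close> and
      \<open>s \<ge> - a > 0\<close>.\<close>
    have "6 * a\<^sup>2 * d k = \<alpha>\<^sup>2 - 1 - (8 * real m + 4 * real n + 2 * \<alpha> + 2) * a + a\<^sup>2
        + 8 * s * (s + a) + (8 * \<alpha> - 4) * s"
      using exceptional_laguerre_zero_relations(2)[OF P_Q[OF k', unfolded P_def] P_char(2) Z(1)[OF k']]
        S_nz[OF k'] Q_nz[OF k'] by (simp add: d_def S_def s_def a_def)
    moreover have "\<alpha>\<^sup>2 \<ge> 1" using assms(2) by (simp add: one_le_power)
    moreover have "(8 * real m + 4 * real n + 2 * \<alpha> + 2) * a < 0"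
      using a assms(2) by (intro mult_pos_neg) auto
    moreover have "8 * s * (s + a) \<ge> 0" "(8 * \<alpha> - 4) * s \<ge> 0"
      using s a assms(2) by (auto intro!: mult_nonneg_nonneg)
    moreover have "a\<^sup>2 \<ge> 0" by simp
    ultimately have "6 * a\<^sup>2 * d k > 0" by linarith
    thus ?thesis using a by (simp add: zero_less_mult_iff)
  qed

  \<comment> \<open>Second derivatives at the positive zeros\<close>
  have d_pos_zero: "d k < 0" if k: "k \<in> {m + 1..m + n}" for k
  proof -
    have k': "k \<in> {1..m + n}" using k by auto
    define a where "a = Z k"
    have a: "a > 0" using xD(1)[OF Z_pos(2)[OF k]] Z_pos(1)[OF k] by (simp add: a_def)
    have simple_z: "poly (pderiv P) (z i) \<noteq> 0" if "i \<in> {1..m}" for i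
      using simple[of i] Z_neg[OF that] that by simp
    obtain \<zeta> where \<zeta>: "\<And>i. i \<in> {1..m} \<Longrightarrow> poly S (\<zeta> i) = 0" "\<And>i. i \<in> {1..m} \<Longrightarrow> z i < \<zeta> i"
      "\<And>i. i \<in> {1..m} \<Longrightarrow> \<zeta> i < (if i = 1 then 0 else z (i - 1))"
      by (rule laguerre_neg_roots_interlace[of \<alpha> m z n])
        (use assms(2-4) simple_z in \<open>auto simp: S_def P_def\<close>)
    \<comment> \<open>The \<open>\<zeta> i\<close> lie in disjoint intervals and are distinct; as
      \<open>S\<close> has degree \<open>m\<close>, they are all of its zeros.\<close>
    have less: "\<zeta> j < \<zeta> i" if "i \<in> {1..m}" "j \<in> {1..m}" "i < j" for i j
    proof -
      have "\<zeta> j < z (j - 1)" using \<zeta>(3)[of j] that by auto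
      also have "z (j - 1) \<le> z i"
      proof (cases "i = j - 1")
        case False
        hence "z (j - 1) < z i"
          using that by (intro monotone_onD[OF assms(3)]) auto
        thus ?thesis by simp
      qed simp
      also have "z i < \<zeta> i" by (rule \<zeta>(2)[OF that(1)])
      finally show ?thesis .
    qed
    have "inj_on \<zeta> {1..m}"
      by (rule inj_onI) (metis less less_irrefl linorder_neqE_nat)
    hence S_prod: "S = smult (lead_coeff S) (\<Prod>i=1..m. [:- \<zeta> i, 1:])"
      by (intro poly_eq_prod_roots) (use \<zeta>(1) in \<open>auto simp: S_def degree_laguerre_neg\<close>)
    have lc: "lead_coeff S \<noteq> 0"
      using S_nz[OF k'] by auto
    have \<zeta>_neq: "\<zeta> i \<noteq> a" if "i \<in> {1..m}" for i
      using \<zeta>(1)[OF that] S_nz[OF k'] by (auto simp: a_def)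
    define R where "R = (\<Prod>i=1..m. [:- \<zeta> i, 1:])"
    have R: "S = smult (lead_coeff S) R" using S_prod by (simp add: R_def)
    \<comment> \<open>A constant factor cancels in the derivative of a logarithmic
      derivative.\<close>
    have "(poly (pderiv (pderiv S)) a * poly S a - (poly (pderiv S) a)\<^sup>2) / (poly S a)\<^sup>2
        = (poly (pderiv (pderiv R)) a * poly R a - (poly (pderiv R) a)\<^sup>2) / (poly R a)\<^sup>2"
    proof -
      define l where "l = lead_coeff S"
      have "S = smult l R" "l \<noteq> 0" using R lc by (simp_all add: l_def)
      moreover have "(l * p * (l * q) - (l * r)\<^sup>2) / (l * q)\<^sup>2 = (p * q - r\<^sup>2) / q\<^sup>2"
        if "l \<noteq> 0" for p q r :: real
      proof -
        have "l * p * (l * q) - (l * r)\<^sup>2 = l\<^sup>2 * (p * q - r\<^sup>2)"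
          by (simp add: power2_eq_square algebra_simps)
        thus ?thesis using that by (simp add: power_mult_distrib)
      qed
      ultimately show ?thesis by (simp add: pderiv_smult)
    qed
    also have "\<dots> = - (\<Sum>i=1..m. 1 / (a - \<zeta> i)\<^sup>2)"
      unfolding R_def by (rule prod_linear_second_log_deriv) (use \<zeta>_neq in auto)
    finally have S_sum: "(poly (pderiv (pderiv S)) a * poly S a - (poly (pderiv S) a)\<^sup>2) / (poly S a)\<^sup>2
      = - (\<Sum>i=1..m. 1 / (a - \<zeta> i)\<^sup>2)" .
    have Q_sum: "(poly (pderiv (pderiv (Q k))) a * poly (Q k) a - (poly (pderiv (Q k)) a)\<^sup>2)
        / (poly (Q k) a)\<^sup>2 = - (\<Sum>i\<in>{1..m + n} - {k}. 1 / (a - Z i)\<^sup>2)"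
      unfolding Q_def by (rule prod_linear_second_log_deriv)
        (simp, use Z_neq[OF k'] in \<open>unfold a_def\<close>, blast)
    have "(\<Sum>i=1..m. 1 / (a - \<zeta> i)\<^sup>2) < 1 / a\<^sup>2 + (\<Sum>i=1..m. 1 / (a - z i)\<^sup>2)"
      by (rule sum_inverse_squares_interlace) (use assms(1) a zD \<zeta> in auto)
    also have "(\<Sum>i=1..m. 1 / (a - z i)\<^sup>2) = (\<Sum>i=1..m. 1 / (a - Z i)\<^sup>2)"
      by (rule sum.cong) (simp_all add: Z_neg)
    \<comment> \<open>Since \<open>k > m\<close>, removing \<open>k\<close> leaves all negative
      zeros in the sum; the other positive zeros only add nonnegative terms.\<close>
    also have "\<dots> \<le> (\<Sum>i\<in>{1..m + n} - {k}. 1 / (a - Z i)\<^sup>2)"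
      using k by (intro sum_mono2) auto
    finally have "(\<Sum>i=1..m. 1 / (a - \<zeta> i)\<^sup>2) < 1 / a\<^sup>2 + (\<Sum>i\<in>{1..m + n} - {k}. 1 / (a - Z i)\<^sup>2)"
      by simp
    moreover have "d k = - (\<alpha> + 1) / a\<^sup>2 + 2 * (\<Sum>i=1..m. 1 / (a - \<zeta> i)\<^sup>2)
        - 2 * (\<Sum>i\<in>{1..m + n} - {k}. 1 / (a - Z i)\<^sup>2)"
      unfolding d_def a_def[symmetric] S_sum Q_sum by simp
    \<comment> \<open>By \<open>\<alpha> \<ge> 1\<close> the weight absorbs twice the surplus
      \<open>1 / a\<^sup>2\<close> of the interlacing bound, whose strictness decides the
      sign.\<close>
    moreover have "- (\<alpha> + 1) / a\<^sup>2 \<le> - 2 * (1 / a\<^sup>2)"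
      using assms(2) divide_right_mono[of "- (\<alpha> + 1)" "- 2" "a\<^sup>2"] by simp
    ultimately show ?thesis by linarith
  qed

  \<comment> \<open>The saddle point\<close>
  have "saddle_point (m + n) logT Z" if "n \<ge> 1"
    unfolding saddle_point_def
  proof (intro conjI allI impI ballI first)
    fix e :: real assume e: "e > 0"
    \<comment> \<open>Moving the coordinate of a negative zero increases the energy, and moving that
      of a positive zero, here index \<open>m + 1\<close>, decreases it.\<close>
    have i: "1 \<in> {1..m}" "1 \<in> {1..m + n}" using assms(1) by auto
    show "\<exists>v. (\<forall>i\<in>{1..m + n}. \<bar>v i - Z i\<bar> < e) \<and> logT v > logT Z"
      using second_partial_increase[where f = logT, OF partial[OF i(2)] g_deriv[OF i(2)]
          d_neg_zero[OF i(1)] critical[OF i(2)] e]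
      by blast
    have j: "m + 1 \<in> {m + 1..m + n}" "m + 1 \<in> {1..m + n}" using that by auto
    show "\<exists>v. (\<forall>i\<in>{1..m + n}. \<bar>v i - Z i\<bar> < e) \<and> logT v < logT Z"
      using second_partial_decrease[where f = logT, OF partial[OF j(2)] g_deriv[OF j(2)]
          d_pos_zero[OF j(1)] critical[OF j(2)] e]
      by blast
  qed
  moreover have "\<exists>d>0. has_second_partial logT i Z d" if "i \<in> {1..m}" for i
    using second[of i] d_neg_zero[OF that] that by auto
  moreover have "\<exists>d<0. has_second_partial logT i Z d" if "i \<in> {m + 1..m + n}" for i
    using second[of i] d_pos_zero[OF that] that by auto
  ultimately show ?thesis using first by blast
qed

end
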